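(* Let $H$ be a real Hilbert space with scalar product $(\cdot,\cdot)$ and norm $\|u\|=\sqrt{(u,u)}$. Let $A: H\to H$ be an odd compact potential operator, and assume that there exists $\theta\in[0,1)$ such that $$\limsup_{\|u\|\to+\infty}\frac{\|Au\|}{\|u\|^{\theta}}<\infty .$$ Assume further that there exist a linear operator $B_1$ on $H$, a real number $r_1>0$, and a vector $e_1\in H$ with $\|e_1\|=1$ such that (i) $\big(B_1(e_1),e_1\big)>1$; (ii) $\big(A(s r_1 e_1), r_1 e_1\big)\geq s\,r_1^2\,\big(B_1(e_1),e_1\big)$ for all $s\in(0,1)$. Then $A$ has a pair of fixed points in $H\setminus\{0\}$; that is, there exists $u\in H$, $u\neq 0$, such that $A(u)=u$ and $A(-u)=-u$.
   Context: A mapping $A: H\to H$ (not necessarily linear) is called compact if it maps bounded sets onto relatively compact sets. It is odd if $A(-u)=-A(u)$ for all $u\in H$. It is a potential operator if there exists a Gâteaux differentiable functional $T: H\to\mathbb{R}$ such that $T'(u)=A(u)$ for every $u\in H$, where the dual of $H$ is identified with $H$ via the scalar product, i.e. the Gâteaux derivative of $T$ at $u$ in direction $v$ equals $(A(u),v)$ for all $u,v\in H$. A pair of fixed points means a set $\{u,-u\}$ with $u\neq 0$ both of whose elements are fixed points of $A$. *)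

theory Defs
  imports "HOL-Analysis.Analysis"
begin

text \<open>No continuity is required of a compact map here.\<close>

definition compact_map :: "('a::metric_space \<Rightarrow> 'b::metric_space) \<Rightarrow> bool" where
  "compact_map A \<longleftrightarrow> (\<forall>S. bounded S \<longrightarrow> compact (closure (A ` S)))"

definition odd_map :: "('a::real_vector \<Rightarrow> 'b::real_vector) \<Rightarrow> bool" where
  "odd_map A \<longleftrightarrow> (\<forall>u. A (- u) = - A u)"

definition has_gateaux_derivative ::
    "('a::real_normed_vector \<Rightarrow> real) \<Rightarrow> ('a \<Rightarrow> real) \<Rightarrow> 'a \<Rightarrow> bool" where
  "has_gateaux_derivative T D u \<longleftrightarrow>
     bounded_linear D \<and>
     (\<forall>v. ((\<lambda>t::real. (T (u + t *\<^sub>R v) - T u) / t) \<longlongrightarrow> D v) (at 0))"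

text \<open>The dual space is identified with the space itself via the inner product.\<close>

definition potential_operator :: "('a::real_inner \<Rightarrow> 'a) \<Rightarrow> bool" where
  "potential_operator A \<longleftrightarrow>
     (\<exists>T. \<forall>u. has_gateaux_derivative T (\<lambda>v. A u \<bullet> v) u)"

end

theory Submission
  imports Defs
begin

text \<open>
  Let \<open>T\<close> be a potential of \<open>A\<close> and \<open>J u = (u \<bullet> u) / 2 - T u\<close>, so that the critical points of \<open>J\<close>
  are the fixed points of \<open>A\<close>. Sublinear growth of \<open>A\<close> makes \<open>J\<close> coercive. Ekeland's principle gives
  a bounded minimizing sequence \<open>u\<^sub>n\<close> with \<open>u\<^sub>n - A u\<^sub>n \<longlonglongrightarrow> 0\<close>; since \<open>A u\<^sub>n\<close> is relatively compact, a
  subsequence converges in norm, and continuity of \<open>J\<close> alone shows that its limit is a minimizer.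
  Neither weak compactness nor continuity of \<open>A\<close> enters. The hypothesis on the segment
  towards \<open>r\<^sub>1 e\<^sub>1\<close> yields \<open>J (r\<^sub>1 e\<^sub>1) < J 0\<close>, so the minimizer is not \<open>0\<close>.
\<close>

section \<open>Ekeland's variational principle in a complete metric space\<close>

text \<open>Descend from \<open>x\<^sub>0\<close>, each time choosing an almost minimal point among
  those still reachable. The decrease of \<open>f\<close> pays for the distance travelled, so the
  path converges, and nothing but the limit itself is reachable from the limit.\<close>

lemma ekeland_variational_principle:
  fixes f :: "'a::complete_space \<Rightarrow> real"
  assumes cont: "continuous_on UNIV f"
    and bdd: "bdd_below (range f)"
    and "\<epsilon> > 0"
  obtains x where "f x \<le> f x\<^sub>0" "\<And>y. y \<noteq> x \<Longrightarrow> f y > f x - \<epsilon> * dist x y"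
proof -
  \<comment> \<open>\<open>S x\<close> collects the points reachable from \<open>x\<close>: the drop
    in \<open>f\<close> must cover \<epsilon> times the distance. Reachability is a partial
    order.\<close>
  define S where "S x = {y. f y + \<epsilon> * dist x y \<le> f x}" for x
  have S_refl: "x \<in> S x" for x
    by (simp add: S_def)
  have S_le: "f y \<le> f x" if "y \<in> S x" for x y
  proof -
    have "0 \<le> \<epsilon> * dist x y" using \<open>\<epsilon> > 0\<close> by simp
    moreover have "f y + \<epsilon> * dist x y \<le> f x" using that by (simp add: S_def)
    ultimately show ?thesis by linarith
  qed
  have S_trans: "z \<in> S x" if "y \<in> S x" "z \<in> S y" for x y z
  proof -
    have "\<epsilon> * dist x z \<le> \<epsilon> * dist x y + \<epsilon> * dist y z"
      using dist_triangle[of x z y] \<open>\<epsilon> > 0\<close> by (simp flip: distrib_left)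
    then show ?thesis using that by (simp add: S_def)
  qed
  have ex: "\<exists>y. y \<in> S x \<and> (\<forall>z\<in>S x. f y < f z + inverse (Suc n))" for x and n :: nat
  proof -
    have bddS: "bdd_below (f ` S x)"
      using bdd by (rule bdd_below_mono) auto
    have "\<exists>y\<in>S x. f y < Inf (f ` S x) + inverse (Suc n)"
      using cInf_lessD[of "f ` S x" "Inf (f ` S x) + inverse (Suc n)"] S_refl by auto
    then show ?thesis
      using cInf_lower[OF _ bddS] by (meson add_le_cancel_right imageI less_le_trans)
  qed
  \<comment> \<open>The guard \<open>n = 0\<close> in the chosen predicate serves only to pin the
    starting point.\<close>
  obtain X where X0: "X 0 = x\<^sub>0" and XS: "\<And>n. X (Suc n) \<in> S (X n)"
    and Xmin: "\<And>n z. z \<in> S (X n) \<Longrightarrow> f (X (Suc n)) < f z + inverse (Suc n)"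
    using dependent_nat_choice[of "\<lambda>n x. n = 0 \<longrightarrow> x = x\<^sub>0"
        "\<lambda>n x y. y \<in> S x \<and> (\<forall>z\<in>S x. f y < f z + inverse (Suc n))"] ex
    by (metis nat.distinct(1))
  have Xle: "X m \<in> S (X n)" if "n \<le> m" for m n
    using that by (induction rule: dec_induct) (auto intro: S_refl S_trans XS)
  then have Xdist: "f (X m) + \<epsilon> * dist (X n) (X m) \<le> f (X n)" if "n \<le> m" for m n
    using that by (simp add: S_def)
  have "decseq (\<lambda>n. f (X n))"
  proof (rule decseq_SucI)
    show "f (X (Suc n)) \<le> f (X n)" for n
      using XS by (rule S_le)
  qed
  moreover obtain m where "\<And>n. m \<le> f (X n)"
    using bdd by (auto simp: bdd_below_def)
  ultimately obtain L where L: "(\<lambda>n. f (X n)) \<longlonglongrightarrow> L"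
    using decseq_convergent by blast
  have "Cauchy X"
  proof (rule metric_CauchyI)
    fix e :: real assume "e > 0"
    \<comment> \<open>The tolerance is \<epsilon> * e because \<epsilon> times a distance along the
      path is at most the drop in \<open>f\<close>.\<close>
    then obtain N where N: "\<And>i j. N \<le> i \<Longrightarrow> N \<le> j \<Longrightarrow> dist (f (X i)) (f (X j)) < \<epsilon> * e"
      using LIMSEQ_imp_Cauchy[OF L] \<open>\<epsilon> > 0\<close> by (metis metric_CauchyD mult_pos_pos)
    have le: "dist (X i) (X j) < e" if "N \<le> i" "i \<le> j" for i j
    proof -
      have "\<epsilon> * dist (X i) (X j) < \<epsilon> * e"
        using N[of i j] Xdist[of i j] that by (simp add: dist_real_def)
      then show ?thesis using \<open>\<epsilon> > 0\<close> by simp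
    qed
    show "\<exists>N. \<forall>i\<ge>N. \<forall>j\<ge>N. dist (X i) (X j) < e"
      by (intro exI[of _ N]) (metis le dist_commute nat_le_linear)
  qed
  then obtain x where x: "X \<longlonglongrightarrow> x"
    by (auto simp: Cauchy_convergent_iff convergent_def)
  have "isCont f x"
    using cont by (simp add: continuous_on_eq_continuous_at)
  then have fx: "(\<lambda>n. f (X n)) \<longlonglongrightarrow> f x"
    using x by (rule isCont_tendsto_compose)
  \<comment> \<open>Each \<open>S (X n)\<close> is closed since \<open>f\<close> is continuous, and
    it contains the tail of the path.\<close>
  have xS: "x \<in> S (X n)" for n
  proof -
    have "(\<lambda>m. f (X m) + \<epsilon> * dist (X n) (X m)) \<longlonglongrightarrow> f x + \<epsilon> * dist (X n) x"
      by (intro tendsto_intros fx x)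
    moreover have "\<forall>m\<ge>n. f (X m) + \<epsilon> * dist (X n) (X m) \<le> f (X n)"
      using Xdist by blast
    ultimately show ?thesis
      unfolding S_def by (auto intro: LIMSEQ_le_const2)
  qed
  show ?thesis
  proof
    show "f x \<le> f x\<^sub>0"
      using S_le[OF xS[of 0]] X0 by simp
    fix y assume "y \<noteq> x"
    show "f y > f x - \<epsilon> * dist x y"
    proof (rule ccontr)
      assume "\<not> ?thesis"
      \<comment> \<open>By transitivity \<open>y\<close> lies in every \<open>S (X n)\<close>, so
        almost minimality of \<open>X (Suc n)\<close> forces \<open>f x\<close> \<le>
        \<open>f y\<close>, against the strict drop from \<open>x\<close> to
        \<open>y\<close>.\<close>
      then have y: "y \<in> S x" by (simp add: S_def)
      have "f (X (Suc n)) \<le> f y + inverse (Suc n)" for n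
        using Xmin[OF S_trans[OF xS y]] by (simp add: less_imp_le)
      moreover have "(\<lambda>n. f y + inverse (Suc n)) \<longlonglongrightarrow> f y"
        using tendsto_add[OF tendsto_const LIMSEQ_inverse_real_of_nat] by force
      moreover have "(\<lambda>n. f (X (Suc n))) \<longlonglongrightarrow> f x"
        using fx by (rule LIMSEQ_Suc)
      ultimately have "f x \<le> f y"
        by (meson LIMSEQ_le)
      moreover have "\<epsilon> * dist x y > 0" using \<open>\<epsilon> > 0\<close> \<open>y \<noteq> x\<close> by simp
      ultimately show False using y by (simp add: S_def)
    qed
  qed
qed

section \<open>Gateaux differentiable functionals along lines\<close>

lemma compact_map_imp_bounded_image:
  assumes "compact_map A" and "bounded S"
  shows "bounded (A ` S)"
proof -
  have "compact (closure (A ` S))"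
    using assms by (simp add: compact_map_def)
  then show ?thesis
    by (rule bounded_subset[OF compact_imp_bounded closure_subset])
qed

text \<open>Moving the base point to \<open>u + s *\<^sub>R v\<close> turns the directional limit at
  0 into an ordinary derivative at \<open>s\<close>, which opens the way to the one-variable mean
  value theorem.\<close>

lemma gateaux_derivative_line:
  assumes "\<And>u. has_gateaux_derivative T (D u) u"
  shows "((\<lambda>t. T (u + t *\<^sub>R v)) has_real_derivative D (u + s *\<^sub>R v) v) (at s)"
proof -
  have "((\<lambda>t. (T ((u + s *\<^sub>R v) + t *\<^sub>R v) - T (u + s *\<^sub>R v)) / t) \<longlongrightarrow> D (u + s *\<^sub>R v) v) (at 0)"
    using assms by (simp add: has_gateaux_derivative_def)
  then show ?thesis
    by (simp add: DERIV_def algebra_simps)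
qed

lemma gateaux_mean_value:
  assumes "\<And>u. has_gateaux_derivative T (D u) u"
  obtains s where "0 < s" "s < 1" "T (u + v) - T u = D (u + s *\<^sub>R v) v"
proof -
  have "\<exists>s>0. s < 1 \<and> T (u + 1 *\<^sub>R v) - T (u + 0 *\<^sub>R v) = (1 - 0) * D (u + s *\<^sub>R v) v"
    by (rule MVT2) (simp_all add: gateaux_derivative_line[OF assms])
  then show ?thesis
    using that by auto
qed

text \<open>A Gateaux derivative alone does not give continuity. A gradient bounded by
  \<open>M\<close> on the unit ball around \<open>u\<close> does: by the mean value theorem,
  \<open>T v\<close> differs from \<open>T u\<close> by at most \<open>M * norm (v - u)\<close>
  there.\<close>

lemma continuous_on_gateaux_bounded_gradient:
  fixes T :: "'h::real_inner \<Rightarrow> real"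
  assumes T: "\<And>u. has_gateaux_derivative T (\<lambda>v. A u \<bullet> v) u"
    and A: "\<And>S. bounded S \<Longrightarrow> bounded (A ` S)"
  shows "continuous_on UNIV T"
proof -
  have "isCont T u" for u
  proof -
    obtain M where M: "\<And>v. v \<in> ball u 1 \<Longrightarrow> norm (A v) \<le> M"
      using A[OF bounded_ball[of u 1]] unfolding bounded_iff by (metis imageI)
    have bound: "norm (T v - T u) \<le> M * norm (v - u)" if "v \<in> ball u 1" for v
    proof -
      obtain s where s: "0 < s" "s < 1" "T (u + (v - u)) - T u = A (u + s *\<^sub>R (v - u)) \<bullet> (v - u)"
        using gateaux_mean_value[OF T] .
      have "s * norm (v - u) \<le> norm (v - u)"
        using s by (intro mult_left_le_one_le) auto
      then have "u + s *\<^sub>R (v - u) \<in> ball u 1"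
        using that s by (simp add: dist_norm norm_minus_commute)
      then have "norm (A (u + s *\<^sub>R (v - u))) * norm (v - u) \<le> M * norm (v - u)"
        by (intro mult_right_mono M) auto
      then show ?thesis
        using s(3) Cauchy_Schwarz_ineq2[of "A (u + s *\<^sub>R (v - u))" "v - u"] by simp
    qed
    have "((\<lambda>v. T v - T u) \<longlongrightarrow> 0) (at u)"
    proof (rule Lim_null_comparison)
      show "\<forall>\<^sub>F v in at u. norm (T v - T u) \<le> M * norm (v - u)"
        using bound by (auto simp: eventually_at dist_commute intro!: exI[of _ 1])
      have "((\<lambda>v. M * norm (v - u)) \<longlongrightarrow> M * norm (u - u)) (at u)"
        by (intro tendsto_intros)
      then show "((\<lambda>v. M * norm (v - u)) \<longlongrightarrow> 0) (at u)" by simp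
    qed
    then show ?thesis
      by (simp add: isCont_def LIM_zero_iff)
  qed
  then show ?thesis
    by (simp add: continuous_on_eq_continuous_at)
qed

lemma has_gateaux_derivative_half_square_minus:
  fixes T :: "'h::real_inner \<Rightarrow> real"
  assumes "has_gateaux_derivative T (\<lambda>v. a \<bullet> v) u"
  shows "has_gateaux_derivative (\<lambda>u. (u \<bullet> u) / 2 - T u) (\<lambda>v. (u - a) \<bullet> v) u"
proof -
  have "((\<lambda>t. (((u + t *\<^sub>R v) \<bullet> (u + t *\<^sub>R v)) / 2 - T (u + t *\<^sub>R v) - ((u \<bullet> u) / 2 - T u)) / t)
    \<longlongrightarrow> (u - a) \<bullet> v) (at 0)" for v
  proof -
    have "((\<lambda>t. u \<bullet> v + t * (v \<bullet> v) / 2 - (T (u + t *\<^sub>R v) - T u) / t)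
      \<longlongrightarrow> u \<bullet> v + 0 * (v \<bullet> v) / 2 - a \<bullet> v) (at 0)"
      using assms by (intro tendsto_intros) (auto simp: has_gateaux_derivative_def)
    then have "((\<lambda>t. u \<bullet> v + t * (v \<bullet> v) / 2 - (T (u + t *\<^sub>R v) - T u) / t)
      \<longlongrightarrow> (u - a) \<bullet> v) (at 0)"
      by (simp add: inner_diff_left)
    moreover have "\<forall>\<^sub>F t in at 0. u \<bullet> v + t * (v \<bullet> v) / 2 - (T (u + t *\<^sub>R v) - T u) / t =
      (((u + t *\<^sub>R v) \<bullet> (u + t *\<^sub>R v)) / 2 - T (u + t *\<^sub>R v) - ((u \<bullet> u) / 2 - T u)) / t"
      unfolding eventually_at
      by (intro exI[of _ 1]) (auto simp: inner_add_left inner_add_right inner_commute field_simps)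
    ultimately show ?thesis
      by (rule Lim_transform_eventually)
  qed
  then show ?thesis
    by (simp add: has_gateaux_derivative_def bounded_linear_inner_right)
qed

text \<open>In the steepest descent direction \<open>- g\<close> the difference quotients for
  positive \<open>t\<close> tend to minus the square of \<open>norm g\<close>, yet stay above
  \<open>- \<epsilon> * norm g\<close>.\<close>

lemma norm_gradient_le_of_almost_minimal:
  fixes f :: "'h::real_inner \<Rightarrow> real"
  assumes G: "has_gateaux_derivative f (\<lambda>v. g \<bullet> v) x"
    and min: "\<And>y. f y \<ge> f x - \<epsilon> * dist x y"
    and "\<epsilon> \<ge> 0"
  shows "norm g \<le> \<epsilon>"
proof -
  have "((\<lambda>t. (f (x + t *\<^sub>R (- g)) - f x) / t) \<longlongrightarrow> g \<bullet> (- g)) (at 0)"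
    using G unfolding has_gateaux_derivative_def by blast
  then have "((\<lambda>t. (f (x + t *\<^sub>R (- g)) - f x) / t) \<longlongrightarrow> g \<bullet> (- g)) (at_right 0)"
    by (rule filterlim_mono) (auto simp: at_le)
  moreover have "\<forall>\<^sub>F t in at_right 0. - \<epsilon> * norm g \<le> (f (x + t *\<^sub>R (- g)) - f x) / t"
    unfolding eventually_at_right_field
  proof (intro exI[of _ 1] conjI allI impI)
    fix t :: real assume "0 < t"
    have "f (x + t *\<^sub>R (- g)) \<ge> f x - \<epsilon> * (t * norm g)"
      using min[of "x + t *\<^sub>R (- g)"] \<open>0 < t\<close> by (simp add: dist_norm)
    then show "- \<epsilon> * norm g \<le> (f (x + t *\<^sub>R (- g)) - f x) / t"
      using \<open>0 < t\<close> by (simp add: pos_le_divide_eq mult.commute mult.left_commute)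
  qed simp
  ultimately have "- \<epsilon> * norm g \<le> g \<bullet> (- g)"
    by (rule tendsto_lowerbound) simp
  then have "norm g * norm g \<le> \<epsilon> * norm g"
    by (simp add: norm_eq_sqrt_inner)
  then show ?thesis
    using \<open>\<epsilon> \<ge> 0\<close> by (cases "g = 0") auto
qed

section \<open>Growth control and existence of a minimizer\<close>

text \<open>The constant \<open>1/4\<close> only has to beat the \<open>1/2\<close> in front of \<open>u \<bullet> u\<close>.\<close>

lemma sublinear_growth_bound:
  fixes A :: "'h::real_normed_vector \<Rightarrow> 'h"
  assumes A: "\<And>S. bounded S \<Longrightarrow> bounded (A ` S)"
    and "\<theta> < 1"
    and lim: "Limsup at_infinity (\<lambda>u. ereal (norm (A u) / norm u powr \<theta>)) < \<infinity>"
  obtains K where "K \<ge> 0" "\<And>u. norm (A u) \<le> K + norm u / 4"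
proof -
  obtain C where "Limsup at_infinity (\<lambda>u. ereal (norm (A u) / norm u powr \<theta>)) < ereal C"
    using lim ereal_dense2 by blast
  then have "\<forall>\<^sub>F u in at_infinity. ereal (norm (A u) / norm u powr \<theta>) < ereal C"
    by (rule Limsup_lessD)
  then have ev1: "\<forall>\<^sub>F u in at_infinity. norm (A u) / norm u powr \<theta> < C"
    by simp
  \<comment> \<open>This is where \<theta> < 1 enters: the exponent \<theta> - 1 is negative, so any
    constant \<open>C\<close> is eventually absorbed.\<close>
  have "((\<lambda>x::real. C * x powr (\<theta> - 1)) \<longlongrightarrow> C * 0) at_top"
    using \<open>\<theta> < 1\<close> by (intro tendsto_intros tendsto_neg_powr filterlim_ident) auto
  then have "\<forall>\<^sub>F x::real in at_top. C * x powr (\<theta> - 1) < 1 / 4"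
    by (intro order_tendstoD(2)[of _ "C * 0"]) auto
  then have ev2: "\<forall>\<^sub>F u::'h in at_infinity. C * norm u powr (\<theta> - 1) < 1 / 4"
    by (rule eventually_compose_filterlim) (rule filterlim_norm_at_top)
  have "\<forall>\<^sub>F u::'h in at_infinity. norm u \<ge> 1"
    by (auto simp: eventually_at_infinity)
  with ev1 ev2 have "\<forall>\<^sub>F u in at_infinity. norm (A u) \<le> norm u / 4"
  proof eventually_elim
    case (elim u)
    have "norm (A u) \<le> C * norm u powr \<theta>"
      using elim by (simp add: divide_less_eq split: if_splits)
    also have "\<dots> = C * norm u powr (\<theta> - 1) * norm u"
      using elim by (simp add: powr_diff)
    also have "\<dots> \<le> (1 / 4) * norm u"
      using elim by (intro mult_right_mono) auto
    finally show ?case by simp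
  qed
  then obtain R where R: "\<And>u. norm u \<ge> R \<Longrightarrow> norm (A u) \<le> norm u / 4"
    by (auto simp: eventually_at_infinity)
  obtain K where K: "K > 0" "\<And>u. norm u \<le> R \<Longrightarrow> norm (A u) \<le> K"
    using A[OF bounded_cball[of 0 R]] by (auto simp: bounded_pos)
  have "norm (A u) \<le> K + norm u / 4" for u
    using K R[of u] K(2)[of u] norm_ge_zero[of u] by argo
  with K(1) show ?thesis
    using that[of K] by simp
qed

lemma compact_potential_minimizer:
  fixes A :: "'h::{real_inner,complete_space} \<Rightarrow> 'h"
  assumes T: "\<And>u. has_gateaux_derivative T (\<lambda>v. A u \<bullet> v) u"
    and "compact_map A"
    and K: "K \<ge> 0" "\<And>u. norm (A u) \<le> K + norm u / 4"
  obtains u where "A u = u" "\<And>v. (u \<bullet> u) / 2 - T u \<le> (v \<bullet> v) / 2 - T v"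
proof -
  define J where "J u = (u \<bullet> u) / 2 - T u" for u
  have A_bounded: "\<And>S. bounded S \<Longrightarrow> bounded (A ` S)"
    using assms(2) by (rule compact_map_imp_bounded_image)
  have J_deriv: "has_gateaux_derivative J (\<lambda>v. (u - A u) \<bullet> v) u" for u
    unfolding J_def by (rule has_gateaux_derivative_half_square_minus[OF T])
  have J_cont: "continuous_on UNIV J"
    unfolding J_def
    by (intro continuous_intros continuous_on_gateaux_bounded_gradient[OF T A_bounded]) auto
  \<comment> \<open>The coefficient 1/4 is what remains of 1/2 after the growth bound, used between
    0 and \<open>u\<close>, gives away another 1/4.\<close>
  have J_lower: "J u \<ge> J 0 + (norm u)\<^sup>2 / 4 - K * norm u" for u
  proof -
    obtain s where s: "0 < s" "s < 1" "T (0 + u) - T 0 = A (0 + s *\<^sub>R u) \<bullet> u"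
      using gateaux_mean_value[OF T] .
    have "s * norm u \<le> norm u"
      using s by (intro mult_left_le_one_le) auto
    then have "norm (A (s *\<^sub>R u)) \<le> K + norm u / 4"
      using K(2)[of "s *\<^sub>R u"] s by simp
    then have "norm (A (s *\<^sub>R u)) * norm u \<le> (K + norm u / 4) * norm u"
      by (intro mult_right_mono) auto
    then have "T u - T 0 \<le> (K + norm u / 4) * norm u"
      using s(3) norm_cauchy_schwarz[of "A (s *\<^sub>R u)" u] by simp
    then show ?thesis
      by (simp add: J_def power2_norm_eq_inner[symmetric] power2_eq_square algebra_simps)
  qed
  \<comment> \<open>Completing the square gives the lower bound.\<close>
  have "J u \<ge> J 0 - K\<^sup>2" for u
    using J_lower[of u] zero_le_power2[of "norm u / 2 - K"]
    by (simp add: power2_eq_square algebra_simps)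
  then have J_bdd: "bdd_below (range J)"
    by (intro bdd_belowI[of _ "J 0 - K\<^sup>2"]) auto
  \<comment> \<open>The same number serves as the gap above the infimum and as Ekeland's slope
    \<epsilon>.\<close>
  have "\<exists>u. J u \<le> Inf (range J) + inverse (Suc n) \<and> norm (u - A u) \<le> inverse (Suc n)" for n
  proof -
    obtain y where y: "J y < Inf (range J) + inverse (Suc n)"
      using cInf_lessD[of "range J" "Inf (range J) + inverse (Suc n)"] by auto
    have "inverse (real (Suc n)) > 0" by simp
    from ekeland_variational_principle[OF J_cont J_bdd this, of y]
    obtain x where x: "J x \<le> J y" "\<And>z. z \<noteq> x \<Longrightarrow> J z > J x - inverse (Suc n) * dist x z"
      by blast
    have "J z \<ge> J x - inverse (Suc n) * dist x z" for z
      using x(2)[of z] by (cases "z = x") auto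
    then have "norm (x - A x) \<le> inverse (Suc n)"
      by (rule norm_gradient_le_of_almost_minimal[OF J_deriv]) simp
    with x(1) y show ?thesis by (intro exI[of _ x]) auto
  qed
  then obtain X where X: "\<And>n. J (X n) \<le> Inf (range J) + inverse (Suc n)"
    and XA: "\<And>n. norm (X n - A (X n)) \<le> inverse (Suc n)"
    by metis
  \<comment> \<open>Being almost fixed bounds the sequence: three quarters of
    \<open>norm (X n)\<close> are at most \<open>K + 1\<close>.\<close>
  have "norm (X n) \<le> 2 * (K + 1)" for n
  proof -
    have "norm (X n) \<le> norm (A (X n)) + inverse (Suc n)"
      using XA[of n] norm_triangle_sub[of "X n" "A (X n)"] by simp
    moreover have "inverse (real (Suc n)) \<le> 1"
      by (simp add: inverse_le_1_iff)
    ultimately show ?thesis using K(1) K(2)[of "X n"] by simp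
  qed
  then have "bounded (range X)"
    by (auto simp: bounded_iff)
  then have "compact (closure (A ` range X))"
    using assms(2) by (simp add: compact_map_def)
  moreover have "\<forall>n. A (X n) \<in> closure (A ` range X)"
    by (meson closure_subset imageI rangeI subsetD)
  ultimately obtain u r where r: "strict_mono r" and u: "(\<lambda>n. A (X (r n))) \<longlonglongrightarrow> u"
    unfolding compact_def o_def by meson
  have inv: "(\<lambda>n. inverse (real (Suc (r n)))) \<longlonglongrightarrow> 0"
    using LIMSEQ_subseq_LIMSEQ[OF LIMSEQ_inverse_real_of_nat r] by (simp add: o_def)
  have "(\<lambda>n. X (r n) - A (X (r n))) \<longlonglongrightarrow> 0"
    using inv by (rule Lim_null_comparison[rotated]) (use XA in auto)
  from tendsto_add[OF this u] have "(\<lambda>n. X (r n)) \<longlonglongrightarrow> u"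
    by simp
  then have "(\<lambda>n. J (X (r n))) \<longlonglongrightarrow> J u"
    using J_cont by (metis UNIV_I continuous_on_eq_continuous_at isCont_tendsto_compose open_UNIV)
  moreover have "(\<lambda>n. Inf (range J) + inverse (Suc (r n))) \<longlonglongrightarrow> Inf (range J)"
    using tendsto_add[OF tendsto_const inv] by force
  ultimately have "J u \<le> Inf (range J)"
    by (rule LIMSEQ_le) (use X in auto)
  then have J_min: "J u \<le> J v" for v
    using cInf_lower[OF _ J_bdd] by (meson order_trans rangeI)
  \<comment> \<open>An exact minimizer is the case \<epsilon> = 0 of almost minimality.\<close>
  have "norm (u - A u) \<le> 0"
    by (rule norm_gradient_le_of_almost_minimal[OF J_deriv]) (use J_min in auto)
  then have "A u = u" by simp
  with J_min show ?thesis
    using that by (simp add: J_def)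
qed

section \<open>Excluding the zero fixed point\<close>

text \<open>\<open>c / 2\<close> is the integral of \<open>s * c\<close> over [0, 1]. In place of
  integrating, the mean value theorem is applied to \<open>T\<close> along the segment minus the
  primitive \<open>t\<^sup>2 * c / 2\<close>.\<close>

lemma potential_ge_of_segment_bound:
  fixes T :: "'h::real_inner \<Rightarrow> real"
  assumes T: "\<And>u. has_gateaux_derivative T (\<lambda>v. A u \<bullet> v) u"
    and b: "\<And>s. 0 < s \<Longrightarrow> s < 1 \<Longrightarrow> A (s *\<^sub>R w) \<bullet> w \<ge> s * c"
  shows "T w - T 0 \<ge> c / 2"
proof -
  have "((\<lambda>t. T (0 + t *\<^sub>R w) - t\<^sup>2 * c / 2) has_real_derivative A (0 + s *\<^sub>R w) \<bullet> w - s * c) (at s)" for s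
    by (rule derivative_eq_intros gateaux_derivative_line[OF T] refl | simp)+
  then obtain s where "0 < s" "s < 1"
      "(T (0 + 1 *\<^sub>R w) - 1\<^sup>2 * c / 2) - (T (0 + 0 *\<^sub>R w) - 0\<^sup>2 * c / 2) = (1 - 0) * (A (0 + s *\<^sub>R w) \<bullet> w - s * c)"
    using MVT2[of 0 1 "\<lambda>t. T (0 + t *\<^sub>R w) - t\<^sup>2 * c / 2" "\<lambda>s. A (0 + s *\<^sub>R w) \<bullet> w - s * c"] by auto
  with b[of s] show ?thesis by simp
qed

theorem theorem1p1:
  fixes A B\<^sub>1 :: "'h::{real_inner,complete_space} \<Rightarrow> 'h"
    and \<theta> r\<^sub>1 :: real
    and e\<^sub>1 :: 'h
  assumes "odd_map A"
    and "compact_map A"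
    and "potential_operator A"
    and "0 \<le> \<theta>" and "\<theta> < 1"
    and "Limsup at_infinity (\<lambda>u. ereal (norm (A u) / norm u powr \<theta>)) < \<infinity>"
    and "linear B\<^sub>1"
    and "r\<^sub>1 > 0"
    and "norm e\<^sub>1 = 1"
    and "B\<^sub>1 e\<^sub>1 \<bullet> e\<^sub>1 > 1"
    and "\<And>s. 0 < s \<Longrightarrow> s < 1 \<Longrightarrow>
           A ((s * r\<^sub>1) *\<^sub>R e\<^sub>1) \<bullet> (r\<^sub>1 *\<^sub>R e\<^sub>1) \<ge> s * r\<^sub>1\<^sup>2 * (B\<^sub>1 e\<^sub>1 \<bullet> e\<^sub>1)"
  shows "\<exists>u. u \<noteq> 0 \<and> A u = u \<and> A (- u) = - u"
proof -
  obtain T where T: "\<And>u. has_gateaux_derivative T (\<lambda>v. A u \<bullet> v) u"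
    using assms(3) by (auto simp: potential_operator_def)
  have A_bounded: "\<And>S. bounded S \<Longrightarrow> bounded (A ` S)"
    using assms(2) by (rule compact_map_imp_bounded_image)
  obtain K where "K \<ge> 0" "\<And>u. norm (A u) \<le> K + norm u / 4"
    using sublinear_growth_bound[of A \<theta>] A_bounded assms(5,6) by blast
  then obtain u where u: "A u = u" and min: "\<And>v. (u \<bullet> u) / 2 - T u \<le> (v \<bullet> v) / 2 - T v"
    using compact_potential_minimizer[OF T assms(2)] by metis
  let ?w = "r\<^sub>1 *\<^sub>R e\<^sub>1"
  have "T ?w - T 0 \<ge> (r\<^sub>1\<^sup>2 * (B\<^sub>1 e\<^sub>1 \<bullet> e\<^sub>1)) / 2"
    by (rule potential_ge_of_segment_bound[OF T]) (use assms(11) in \<open>simp add: mult.assoc\<close>)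
  \<comment> \<open>The gain in \<open>T\<close> thus strictly exceeds half of
    \<open>r\<^sub>1\<^sup>2\<close>, the cost of the quadratic term at \<open>?w\<close>.\<close>
  moreover have "r\<^sub>1\<^sup>2 * 1 < r\<^sub>1\<^sup>2 * (B\<^sub>1 e\<^sub>1 \<bullet> e\<^sub>1)"
    using assms(8,10) by (intro mult_strict_left_mono) auto
  moreover have "?w \<bullet> ?w = r\<^sub>1\<^sup>2"
    using assms(8,9) by (simp add: power2_norm_eq_inner[symmetric])
  \<comment> \<open>The right-hand side is the value at 0 of the functional minimized by
    \<open>u\<close>.\<close>
  ultimately have "(?w \<bullet> ?w) / 2 - T ?w < - T 0"
    by simp
  then have "u \<noteq> 0"
    using min[of ?w] by auto
  moreover have "A (- u) = - u"
    using assms(1) u by (simp add: odd_map_def)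
  ultimately show ?thesis
    using u by blast
qed

end
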